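(* The following two statements are equivalent: (A) For all positive integers $n,k$ and every $n\times k$ matrix $M$ with entries in $\{0,1\}$: if the bipartite graph with both parts of size $nk$ and with bipartite adjacency matrix $M\otimes M^T$ has a perfect matching, then the ordinary (non-bipartite) graph on $[n]\times[k]$ with adjacency matrix $M\otimes M^T$ also has a perfect matching. (B) For all positive integers $n,k$ and every $n\times k$ matrix $M$ with non-negative integer entries, all row sums equal to $k$ and all column sums equal to $n$, the (non-bipartite, $nk$-regular) multigraph on the $nk$ vertices $[n]\times[k]$ with adjacency matrix $M\otimes M^T$ has a perfect matching.
   Context: For an $n\times k$ matrix $M$, in this statement $M\otimes M^T$ denotes the symmetric $nk\times nk$ matrix with rows and columns indexed by pairs $(x,y)\in[n]\times[k]$ and entries $(M\otimes M^T)((x_1,y_1),(x_2,y_2)) := M(x_1,y_2)\,M(x_2,y_1)$ (this is not exactly the usual tensor product). The bipartite graph with bipartite adjacency matrix $N$ has the rows of $N$ as left vertices and the columns of $N$ as right vertices (two disjoint copies of $[n]\times[k]$ here), a row being joined to a column iff the entry is nonzero. The ordinary (multi)graph with adjacency matrix $M\otimes M^T$ may have loops (a nonzero diagonal entry gives a loop). A perfect matching in a (multi)graph with vertex set $V$ is an involution $\theta$ on $V$ (a map with $\theta^2=\mathrm{id}$, fixed points allowed) such that for every $v\in V$ there is an edge between $v$ and $\theta(v)$; in particular a vertex with a loop may be matched to itself. *)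

theory Defs
  imports Main "Jordan_Normal_Form.Matrix"
begin

text \<open>
  A multigraph, possibly with loops, is given by its vertex set \<open>V\<close> and its symmetric
  adjacency matrix \<open>A\<close>, where \<open>A u v\<close> is the number of edges between \<open>u\<close> and \<open>v\<close>.
  Only the values of \<open>A\<close> and \<open>\<theta>\<close> on \<open>V\<close> matter. Fixed points of \<open>\<theta>\<close>
  are allowed, so a vertex carrying a loop may be matched to itself.
\<close>

definition perfect_matching :: "'v set \<Rightarrow> ('v \<Rightarrow> 'v \<Rightarrow> nat) \<Rightarrow> ('v \<Rightarrow> 'v) \<Rightarrow> bool" where
  "perfect_matching V A \<theta> \<longleftrightarrow>
     \<theta> ` V \<subseteq> V \<and> (\<forall>v\<in>V. \<theta> (\<theta> v) = v) \<and> (\<forall>v\<in>V. A v (\<theta> v) \<noteq> 0)"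

definition has_perfect_matching :: "'v set \<Rightarrow> ('v \<Rightarrow> 'v \<Rightarrow> nat) \<Rightarrow> bool" where
  "has_perfect_matching V A \<longleftrightarrow> (\<exists>\<theta>. perfect_matching V A \<theta>)"

text \<open>
  Adjacency matrix of the bipartite graph with bipartite adjacency matrix \<open>N\<close>: the rows of
  \<open>N\<close> are the left vertices \<open>Inl r\<close>, its columns the right vertices \<open>Inr c\<close>.
\<close>

fun bipartite_adj :: "('r \<Rightarrow> 'c \<Rightarrow> nat) \<Rightarrow> 'r + 'c \<Rightarrow> 'r + 'c \<Rightarrow> nat" where
  "bipartite_adj N (Inl r) (Inr c) = of_bool (N r c \<noteq> 0)"
| "bipartite_adj N (Inr c) (Inl r) = of_bool (N r c \<noteq> 0)"
| "bipartite_adj N (Inl _) (Inl _) = 0"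
| "bipartite_adj N (Inr _) (Inr _) = 0"

text \<open>
  The matrix written \<open>M \<otimes> M\<^sup>T\<close>. It is not the usual Kronecker product: rows and columns are
  both indexed by pairs (row of \<open>M\<close>, column of \<open>M\<close>), which makes it symmetric. Indices of
  \<open>M\<close> start at \<open>0\<close>, so \<open>[n] \<times> [k]\<close> is \<open>{..<n} \<times> {..<k}\<close>.
\<close>

fun tensor_transpose :: "nat mat \<Rightarrow> nat \<times> nat \<Rightarrow> nat \<times> nat \<Rightarrow> nat" where
  "tensor_transpose M (x1, y1) (x2, y2) = M $$ (x1, y2) * M $$ (x2, y1)"

end

theory Submission
  imports Defs
begin

text \<open>
  The perfect matchings in question depend only on the support of \<open>M\<close>: an edge of \<open>M \<otimes> M\<^sup>T\<close> between
  \<open>(x\<^sub>1, y\<^sub>1)\<close> and \<open>(x\<^sub>2, y\<^sub>2)\<close> exists iff \<open>(x\<^sub>1, y\<^sub>2)\<close> and \<open>(x\<^sub>2, y\<^sub>1)\<close> both lie in the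
  support. A perfect matching of the bipartite graph is the same thing as a permutation
  \<open>\<sigma>\<close> of \<open>[n] \<times> [k]\<close> that moves every cell along such an edge
  (\<open>has_perfect_matching_bipartite_iff\<close>). So the theorem reduces to comparing
  the two hypotheses: if the support carries weights as in (B), then it admits such a
  permutation; and if it admits such a permutation, then part of it carries such weights.

  If \<open>M\<close> has row sums \<open>k\<close> and column sums \<open>n\<close>, then each row and each column of \<open>M \<otimes> M\<^sup>T\<close>
  sums to \<open>n k\<close>. A regular bipartite multigraph satisfies Hall's condition, so a permutation
  \<open>\<sigma>\<close> exists (\<open>regular_imp_permutation\<close>), and (A) applied to the indicator matrix of the
  support of \<open>M\<close> yields (B).

  Conversely, given \<open>\<sigma>\<close>, let \<open>P x y'\<close> be the number of \<open>y\<close> such that \<open>\<sigma> (x, y)\<close> lies in column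
  \<open>y'\<close>. Each of the \<open>k\<close> cells of row \<open>x\<close> is counted once, so row \<open>x\<close> of \<open>P\<close> sums to \<open>k\<close>; column
  \<open>y'\<close> of \<open>P\<close> counts the cells that \<open>\<sigma>\<close> sends to column \<open>y'\<close>, and there are \<open>n\<close> of them because
  \<open>\<sigma>\<close> is a bijection. The support of \<open>P\<close> lies in that of \<open>M\<close>, so the involution that (B) provides
  for \<open>P\<close> is a perfect matching for \<open>M\<close>.
\<close>

section \<open>Hall's theorem and regular bipartite multigraphs\<close>

text \<open>
  Rado's argument: shrink the sets one element at a time while Hall's condition persists.
  If neither of two elements \<open>x\<close>, \<open>y\<close> of one set \<open>A i\<close> can be deleted, then submodularity
  of the cardinality shows that Hall's condition already fails for the union of the two
  obstructing subfamilies or for what they share besides \<open>i\<close>. So the process ends with singletons, which Hall's condition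
  makes distinct.
\<close>

lemma hall_transversal:
  fixes A :: "'i \<Rightarrow> 'a set"
  assumes "finite I" and "\<And>i. i \<in> I \<Longrightarrow> finite (A i)"
    and "\<And>J. J \<subseteq> I \<Longrightarrow> card J \<le> card (\<Union>i\<in>J. A i)"
  shows "\<exists>f. inj_on f I \<and> (\<forall>i\<in>I. f i \<in> A i)"
  using assms
proof (induction "\<Sum>i\<in>I. card (A i)" arbitrary: A rule: less_induct)
  case less
  note fin = less.prems(2) and hall = less.prems(3)
  have nonempty: "A i \<noteq> {}" if "i \<in> I" for i
    using hall[of "{i}"] that by auto
  show ?case
  proof (cases "\<forall>i\<in>I. \<exists>a. A i = {a}")
    case True
    then obtain f where f: "\<And>i. i \<in> I \<Longrightarrow> A i = {f i}"
      by metis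
    have "inj_on f I"
    proof (rule inj_onI, rule ccontr)
      fix i j assume ij: "i \<in> I" "j \<in> I" "f i = f j" "i \<noteq> j"
      then have "(\<Union>l\<in>{i, j}. A l) = {f i}"
        using f by auto
      with hall[of "{i, j}"] ij show False
        by simp
    qed
    with f show ?thesis by auto
  next
    case False
    then obtain i x y where i: "i \<in> I" and xy: "x \<in> A i" "y \<in> A i" "x \<noteq> y"
      using nonempty by blast
    \<comment> \<open>An obstruction to deleting \<open>z\<close> from \<open>A i\<close> must contain \<open>i\<close>; \<open>J\<close> is what remains of it.\<close>
    have delete: "(\<exists>f. inj_on f I \<and> (\<forall>j\<in>I. f j \<in> A j)) \<or>
        (\<exists>J. J \<subseteq> I - {i} \<and> card ((\<Union>j\<in>J. A j) \<union> (A i - {z})) \<le> card J)"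
      if z: "z \<in> A i" for z
    proof (cases "\<forall>J\<subseteq>I. card J \<le> card (\<Union>j\<in>J. (A(i := A i - {z})) j)")
      case True
      let ?B = "A(i := A i - {z})"
      have "(\<Sum>j\<in>I. card (?B j)) < (\<Sum>j\<in>I. card (A j))"
      proof (rule sum_strict_mono_ex1[OF less.prems(1)])
        show "\<forall>j\<in>I. card (?B j) \<le> card (A j)"
          using fin by (auto intro: card_mono)
        show "\<exists>j\<in>I. card (?B j) < card (A j)"
          using card_Diff1_less[OF fin[OF i] z] i by (intro bexI[of _ i]) auto
      qed
      then have "\<exists>f. inj_on f I \<and> (\<forall>j\<in>I. f j \<in> ?B j)"
        by (rule less.hyps) (use less.prems(1) fin True in auto)
      moreover have "?B j \<subseteq> A j" for j by auto
      ultimately show ?thesis by blast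
    next
      case False
      then obtain K where K: "K \<subseteq> I" "card (\<Union>j\<in>K. (A(i := A i - {z})) j) < card K"
        by (auto simp: not_le)
      have "i \<in> K"
      proof (rule ccontr)
        assume "i \<notin> K"
        then have "(\<Union>j\<in>K. (A(i := A i - {z})) j) = (\<Union>j\<in>K. A j)"
          by (intro SUP_cong) auto
        with K hall[of K] show False by simp
      qed
      have "(\<Union>j\<in>K. (A(i := A i - {z})) j) = (\<Union>j\<in>K - {i}. A j) \<union> (A i - {z})"
        using \<open>i \<in> K\<close> by (auto split: if_splits)
      moreover have "card K = Suc (card (K - {i}))"
        using \<open>i \<in> K\<close> K(1) less.prems(1) by (metis card.remove finite_subset)
      ultimately show ?thesis
        using K by (intro disjI2 exI[of _ "K - {i}"]) auto
    qed
    have "False"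
      if J: "J \<subseteq> I - {i}" "card ((\<Union>j\<in>J. A j) \<union> (A i - {x})) \<le> card J"
        and K: "K \<subseteq> I - {i}" "card ((\<Union>j\<in>K. A j) \<union> (A i - {y})) \<le> card K" for J K
    proof -
      let ?X = "(\<Union>j\<in>J. A j) \<union> (A i - {x})" and ?Y = "(\<Union>j\<in>K. A j) \<union> (A i - {y})"
      have finJK: "finite J" "finite K"
        using J(1) K(1) less.prems(1) by (auto intro: finite_subset)
      have finXY: "finite ?X" "finite ?Y"
        using finJK J(1) K(1) i fin by auto
      \<comment> \<open>As \<open>x \<noteq> y\<close>, the two punctured copies of \<open>A i\<close> together cover \<open>A i\<close>.\<close>
      have "?X \<union> ?Y = (\<Union>j\<in>insert i (J \<union> K). A j)"
        using xy by auto
      then have un: "card (insert i (J \<union> K)) \<le> card (?X \<union> ?Y)"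
        using hall[of "insert i (J \<union> K)"] i J(1) K(1)
        by (metis Diff_subset Un_least insert_subset subset_trans)
      have "card (J \<inter> K) \<le> card (\<Union>j\<in>J \<inter> K. A j)"
        using hall[of "J \<inter> K"] J(1) by blast
      also have "\<dots> \<le> card (?X \<inter> ?Y)"
        using finXY by (intro card_mono) auto
      finally have int: "card (J \<inter> K) \<le> card (?X \<inter> ?Y)" .
      have "card (insert i (J \<union> K)) = Suc (card (J \<union> K))"
        using finJK J(1) K(1) by (subst card_insert_disjoint) auto
      moreover have "card J + card K = card (J \<union> K) + card (J \<inter> K)"
        by (rule card_Un_Int[OF finJK])
      moreover have "card ?X + card ?Y = card (?X \<union> ?Y) + card (?X \<inter> ?Y)"
        by (rule card_Un_Int[OF finXY])
      ultimately show False
        using un int J(2) K(2) by linarith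
    qed
    with delete[OF xy(1)] delete[OF xy(2)] show ?thesis by blast
  qed
qed

text \<open>
  Hall's condition holds by double counting: the \<open>d * card J\<close> edges leaving \<open>J\<close> all end in
  the neighbourhood of \<open>J\<close>, each vertex of which absorbs at most \<open>d\<close> of them.
\<close>

lemma regular_imp_permutation:
  fixes A :: "'v \<Rightarrow> 'v \<Rightarrow> nat"
  assumes fin: "finite V" and "d > 0"
    and row: "\<And>v. v \<in> V \<Longrightarrow> (\<Sum>w\<in>V. A v w) = d"
    and col: "\<And>w. w \<in> V \<Longrightarrow> (\<Sum>v\<in>V. A v w) = d"
  shows "\<exists>\<sigma>. bij_betw \<sigma> V V \<and> (\<forall>v\<in>V. A v (\<sigma> v) \<noteq> 0)"
proof -
  define N where "N v = {w \<in> V. A v w \<noteq> 0}" for v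
  have "card J \<le> card (\<Union>v\<in>J. N v)" if J: "J \<subseteq> V" for J
  proof -
    let ?NJ = "\<Union>v\<in>J. N v"
    have NJ: "?NJ \<subseteq> V" "finite ?NJ"
      using fin by (auto simp: N_def intro: finite_subset)
    have "card J * d = (\<Sum>v\<in>J. \<Sum>w\<in>V. A v w)"
      using J row by (simp add: subset_iff)
    also have "\<dots> = (\<Sum>v\<in>J. \<Sum>w\<in>?NJ. A v w)"
      using NJ fin J by (intro sum.cong sum.mono_neutral_right) (auto simp: N_def)
    also have "\<dots> = (\<Sum>w\<in>?NJ. \<Sum>v\<in>J. A v w)"
      by (rule sum.swap)
    also have "\<dots> \<le> (\<Sum>w\<in>?NJ. \<Sum>v\<in>V. A v w)"
      using J fin by (intro sum_mono sum_mono2) auto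
    also have "\<dots> = card ?NJ * d"
      using NJ col by (simp add: subset_iff)
    finally show ?thesis using \<open>d > 0\<close> by simp
  qed
  then obtain \<sigma> where \<sigma>: "inj_on \<sigma> V" "\<forall>v\<in>V. \<sigma> v \<in> N v"
    using hall_transversal[of V N] fin by (auto simp: N_def)
  have "\<sigma> ` V \<subseteq> V"
    using \<sigma>(2) by (auto simp: N_def)
  then have "bij_betw \<sigma> V V"
    using \<sigma>(1) fin by (simp add: bij_betw_def endo_inj_surj)
  with \<sigma>(2) show ?thesis by (auto simp: N_def)
qed

section \<open>Perfect matchings as permutations\<close>

text \<open>
  An edge joins the two copies of \<open>V\<close>, so the involution swaps them: its restriction to the
  left copy is \<open>\<sigma>\<close>, and its restriction to the right copy is then forced to be the inverse of \<open>\<sigma>\<close>.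
\<close>

lemma has_perfect_matching_bipartite_iff:
  "has_perfect_matching (V <+> V) (bipartite_adj N) \<longleftrightarrow>
     (\<exists>\<sigma>. bij_betw \<sigma> V V \<and> (\<forall>v\<in>V. N v (\<sigma> v) \<noteq> 0))"
proof
  assume "has_perfect_matching (V <+> V) (bipartite_adj N)"
  then obtain \<theta> where maps: "\<theta> ` (V <+> V) \<subseteq> V <+> V"
    and invol: "\<And>u. u \<in> V <+> V \<Longrightarrow> \<theta> (\<theta> u) = u"
    and edge: "\<And>u. u \<in> V <+> V \<Longrightarrow> bipartite_adj N u (\<theta> u) \<noteq> 0"
    unfolding has_perfect_matching_def perfect_matching_def by blast
  have "\<exists>w\<in>V. \<theta> (Inl v) = Inr w \<and> N v w \<noteq> 0" if "v \<in> V" for v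
  proof -
    have "Inl v \<in> V <+> V"
      using that by blast
    with maps edge[of "Inl v"] show ?thesis
      by (cases "\<theta> (Inl v)") (force dest: subsetD)+
  qed
  then obtain \<sigma> where \<sigma>: "\<And>v. v \<in> V \<Longrightarrow> \<sigma> v \<in> V \<and> \<theta> (Inl v) = Inr (\<sigma> v) \<and> N v (\<sigma> v) \<noteq> 0"
    by metis
  have "\<exists>v\<in>V. \<theta> (Inr w) = Inl v" if "w \<in> V" for w
  proof -
    have "Inr w \<in> V <+> V"
      using that by blast
    with maps edge[of "Inr w"] show ?thesis
      by (cases "\<theta> (Inr w)") (force dest: subsetD)+
  qed
  then obtain \<tau> where \<tau>: "\<And>w. w \<in> V \<Longrightarrow> \<tau> w \<in> V \<and> \<theta> (Inr w) = Inl (\<tau> w)"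
    by metis
  have "\<tau> (\<sigma> v) = v" if "v \<in> V" for v
    using invol[of "Inl v"] \<sigma> \<tau> that by auto
  moreover have "\<sigma> (\<tau> w) = w" if "w \<in> V" for w
    using invol[of "Inr w"] \<sigma> \<tau> that by auto
  ultimately have "bij_betw \<sigma> V V"
    using \<sigma> \<tau> by (intro bij_betw_byWitness[where f' = \<tau>]) auto
  with \<sigma> show "\<exists>\<sigma>. bij_betw \<sigma> V V \<and> (\<forall>v\<in>V. N v (\<sigma> v) \<noteq> 0)" by blast
next
  assume "\<exists>\<sigma>. bij_betw \<sigma> V V \<and> (\<forall>v\<in>V. N v (\<sigma> v) \<noteq> 0)"
  then obtain \<sigma> where \<sigma>: "bij_betw \<sigma> V V" "\<And>v. v \<in> V \<Longrightarrow> N v (\<sigma> v) \<noteq> 0"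
    by blast
  let ?\<tau> = "inv_into V \<sigma>"
  have inv: "?\<tau> w \<in> V" "\<sigma> (?\<tau> w) = w" if "w \<in> V" for w
    using \<sigma>(1) that by (auto simp: bij_betw_def inv_into_into f_inv_into_f)
  have "perfect_matching (V <+> V) (bipartite_adj N) (case_sum (Inr \<circ> \<sigma>) (Inl \<circ> ?\<tau>))"
    unfolding perfect_matching_def
    using \<sigma> inv \<sigma>(2)[OF inv(1)] bij_betw_inv_into_left[OF \<sigma>(1)] bij_betwE[OF \<sigma>(1)]
    by auto
  then show "has_perfect_matching (V <+> V) (bipartite_adj N)"
    unfolding has_perfect_matching_def by blast
qed

text \<open>The multiplicities matter only through the support; this transfers matchings between matrices.\<close>

lemma has_perfect_matching_mono_support:
  assumes "has_perfect_matching V A"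
    and "\<And>u v. u \<in> V \<Longrightarrow> v \<in> V \<Longrightarrow> A u v \<noteq> 0 \<Longrightarrow> B u v \<noteq> 0"
  shows "has_perfect_matching V B"
  using assms unfolding has_perfect_matching_def perfect_matching_def
  by (metis image_subset_iff)

section \<open>Weights with constant row and column sums\<close>

lemma tensor_transpose_row_sum:
  assumes "\<forall>x<n. (\<Sum>y<k. M $$ (x, y)) = k" and "\<forall>y<k. (\<Sum>x<n. M $$ (x, y)) = n"
    and "v \<in> {..<n} \<times> {..<k}"
  shows "(\<Sum>w\<in>{..<n} \<times> {..<k}. tensor_transpose M v w) = n * k"
proof -
  obtain x y where v: "v = (x, y)" "x < n" "y < k"
    using assms(3) by auto
  have "(\<Sum>w\<in>{..<n} \<times> {..<k}. tensor_transpose M v w)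
      = (\<Sum>x'<n. \<Sum>y'<k. M $$ (x, y') * M $$ (x', y))"
    unfolding sum.cartesian_product by (rule sum.cong) (auto simp: v(1))
  also have "\<dots> = (\<Sum>x'<n. M $$ (x', y)) * (\<Sum>y'<k. M $$ (x, y'))"
    by (simp add: sum_product mult.commute)
  finally show ?thesis using assms v by simp
qed

lemma tensor_transpose_sym: "tensor_transpose M v w = tensor_transpose M w v"
  by (cases v; cases w) (simp add: mult.commute)

lemma constant_sums_imp_permutation:
  assumes "n > 0" "k > 0"
    and "\<forall>x<n. (\<Sum>y<k. M $$ (x, y)) = k" and "\<forall>y<k. (\<Sum>x<n. M $$ (x, y)) = n"
  shows "\<exists>\<sigma>. bij_betw \<sigma> ({..<n} \<times> {..<k}) ({..<n} \<times> {..<k}) \<and>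
    (\<forall>v\<in>{..<n} \<times> {..<k}. tensor_transpose M v (\<sigma> v) \<noteq> 0)"
proof (rule regular_imp_permutation)
  fix w :: "nat \<times> nat" assume "w \<in> {..<n} \<times> {..<k}"
  then show "(\<Sum>v\<in>{..<n} \<times> {..<k}. tensor_transpose M v w) = n * k"
    unfolding tensor_transpose_sym[of M _ w] by (rule tensor_transpose_row_sum[OF assms(3,4)])
qed (use assms in \<open>auto intro: tensor_transpose_row_sum\<close>)

text \<open>
  The matrix \<open>P\<close> of the converse direction: row \<open>x\<close> records how the cells of row \<open>x\<close> are
  distributed by \<open>\<sigma>\<close> over the columns.
\<close>

definition column_count :: "nat \<Rightarrow> nat \<Rightarrow> (nat \<times> nat \<Rightarrow> nat \<times> nat) \<Rightarrow> nat mat" where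
  "column_count n k \<sigma> = mat n k (\<lambda>(x, y'). card {y. y < k \<and> snd (\<sigma> (x, y)) = y'})"

lemma column_count_row_sum:
  assumes "bij_betw \<sigma> ({..<n} \<times> {..<k}) ({..<n} \<times> {..<k})" and "x < n"
  shows "(\<Sum>y'<k. column_count n k \<sigma> $$ (x, y')) = k"
proof -
  have "snd (\<sigma> (x, y)) < k" if "y < k" for y
    using bij_betwE[OF assms(1)] assms(2) that by (fastforce simp: mem_Times_iff)
  then have "(\<Sum>y'<k. \<Sum>y\<in>{y \<in> {..<k}. snd (\<sigma> (x, y)) = y'}. 1) = (\<Sum>y<k. 1 :: nat)"
    by (intro sum.group) auto
  then show ?thesis
    using assms(2) by (simp add: column_count_def)
qed

text \<open>
  Column \<open>y'\<close> counts all cells that \<open>\<sigma>\<close> sends into column \<open>y'\<close>; by bijectivity these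
  correspond to the \<open>n\<close> cells of that column.
\<close>

lemma column_count_column_sum:
  assumes \<sigma>: "bij_betw \<sigma> ({..<n} \<times> {..<k}) ({..<n} \<times> {..<k})" and "y' < k"
  shows "(\<Sum>x<n. column_count n k \<sigma> $$ (x, y')) = n"
proof -
  let ?V = "{..<n} \<times> {..<k}"
  let ?S = "SIGMA x:{..<n}. {y. y < k \<and> snd (\<sigma> (x, y)) = y'}"
  have "(\<Sum>x<n. column_count n k \<sigma> $$ (x, y')) = card ?S"
    using assms(2) by (simp add: column_count_def)
  also have "\<dots> = card (\<sigma> ` ?S)"
  proof -
    have "?S \<subseteq> ?V" by blast
    with bij_betw_imp_inj_on[OF \<sigma>] have "inj_on \<sigma> ?S"
      by (rule inj_on_subset)
    then show ?thesis by (rule card_image[symmetric])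
  qed
  also have "\<sigma> ` ?S = {..<n} \<times> {y'}"
  proof
    show "\<sigma> ` ?S \<subseteq> {..<n} \<times> {y'}"
    proof
      fix w assume "w \<in> \<sigma> ` ?S"
      then obtain x y where "x < n" "y < k" "snd (\<sigma> (x, y)) = y'" "w = \<sigma> (x, y)"
        by blast
      with bij_betwE[OF \<sigma>] show "w \<in> {..<n} \<times> {y'}"
        by (auto simp: mem_Times_iff)
    qed
    show "{..<n} \<times> {y'} \<subseteq> \<sigma> ` ?S"
    proof
      fix w assume w: "w \<in> {..<n} \<times> {y'}"
      then have "w \<in> \<sigma> ` ?V"
        unfolding bij_betw_imp_surj_on[OF \<sigma>] using assms(2) by blast
      then obtain x y where "x < n" "y < k" "w = \<sigma> (x, y)"
        by blast
      with w show "w \<in> \<sigma> ` ?S" by force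
    qed
  qed
  finally show ?thesis by simp
qed

theorem theorem6:
  shows "(\<forall>n k. \<forall>M \<in> carrier_mat n k.
            n > 0 \<longrightarrow> k > 0 \<longrightarrow>
            (\<forall>x<n. \<forall>y<k. M $$ (x, y) \<in> {0, 1}) \<longrightarrow>
            has_perfect_matching (({..<n} \<times> {..<k}) <+> ({..<n} \<times> {..<k}))
              (bipartite_adj (tensor_transpose M)) \<longrightarrow>
            has_perfect_matching ({..<n} \<times> {..<k}) (tensor_transpose M))
     \<longleftrightarrow>
         (\<forall>n k. \<forall>M \<in> carrier_mat n k.
            n > 0 \<longrightarrow> k > 0 \<longrightarrow>
            (\<forall>x<n. (\<Sum>y<k. M $$ (x, y)) = k) \<longrightarrow>
            (\<forall>y<k. (\<Sum>x<n. M $$ (x, y)) = n) \<longrightarrow>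
            has_perfect_matching ({..<n} \<times> {..<k}) (tensor_transpose M))"
    (is "?A \<longleftrightarrow> ?B")
proof (intro iffI allI ballI impI)
  fix n k :: nat and M :: "nat mat"
  assume A: ?A and M: "M \<in> carrier_mat n k" and pos: "n > 0" "k > 0"
    and sums: "\<forall>x<n. (\<Sum>y<k. M $$ (x, y)) = k" "\<forall>y<k. (\<Sum>x<n. M $$ (x, y)) = n"
  \<comment> \<open>Condition (A) speaks of \<open>0/1\<close> matrices, so it is applied to the support of \<open>M\<close>.\<close>
  define S :: "nat mat" where "S = mat n k (\<lambda>i. of_bool (M $$ i \<noteq> 0))"
  have S: "S \<in> carrier_mat n k" "\<forall>x<n. \<forall>y<k. S $$ (x, y) \<in> {0, 1}"
    by (auto simp: S_def)
  have supp: "tensor_transpose S v w \<noteq> 0 \<longleftrightarrow> tensor_transpose M v w \<noteq> 0"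
    if "v \<in> {..<n} \<times> {..<k}" "w \<in> {..<n} \<times> {..<k}" for v w
    using that by (auto simp: S_def)
  obtain \<sigma> where \<sigma>: "bij_betw \<sigma> ({..<n} \<times> {..<k}) ({..<n} \<times> {..<k})"
    "\<forall>v\<in>{..<n} \<times> {..<k}. tensor_transpose M v (\<sigma> v) \<noteq> 0"
    using constant_sums_imp_permutation[OF pos sums] by blast
  then have "\<forall>v\<in>{..<n} \<times> {..<k}. tensor_transpose S v (\<sigma> v) \<noteq> 0"
    using supp bij_betwE[OF \<sigma>(1)] by blast
  with \<sigma>(1) have "has_perfect_matching (({..<n} \<times> {..<k}) <+> ({..<n} \<times> {..<k}))
      (bipartite_adj (tensor_transpose S))"
    unfolding has_perfect_matching_bipartite_iff by blast
  with A S pos have "has_perfect_matching ({..<n} \<times> {..<k}) (tensor_transpose S)"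
    by blast
  then show "has_perfect_matching ({..<n} \<times> {..<k}) (tensor_transpose M)"
    by (rule has_perfect_matching_mono_support) (use supp in blast)
next
  fix n k :: nat and M :: "nat mat"
  assume B: ?B and M: "M \<in> carrier_mat n k" and pos: "n > 0" "k > 0"
    and "has_perfect_matching (({..<n} \<times> {..<k}) <+> ({..<n} \<times> {..<k}))
      (bipartite_adj (tensor_transpose M))"
  then obtain \<sigma> where \<sigma>: "bij_betw \<sigma> ({..<n} \<times> {..<k}) ({..<n} \<times> {..<k})"
    "\<And>v. v \<in> {..<n} \<times> {..<k} \<Longrightarrow> tensor_transpose M v (\<sigma> v) \<noteq> 0"
    unfolding has_perfect_matching_bipartite_iff by blast
  let ?P = "column_count n k \<sigma>"
  have "?P \<in> carrier_mat n k"
    by (simp add: column_count_def)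
  with B pos column_count_row_sum[OF \<sigma>(1)] column_count_column_sum[OF \<sigma>(1)]
  have matching: "has_perfect_matching ({..<n} \<times> {..<k}) (tensor_transpose ?P)"
    by blast
  \<comment> \<open>A cell \<open>(x, y)\<close> counted by \<open>P x y'\<close> moves along an edge, which has \<open>M (x, y')\<close> as a factor.\<close>
  have supp: "M $$ (x, y') \<noteq> 0" if P: "?P $$ (x, y') \<noteq> 0" and lt: "x < n" "y' < k" for x y'
  proof -
    have "{y. y < k \<and> snd (\<sigma> (x, y)) = y'} \<noteq> {}"
      using P lt by (auto simp: column_count_def)
    then obtain y where "y < k" "snd (\<sigma> (x, y)) = y'" by blast
    with \<sigma>(2)[of "(x, y)"] lt show ?thesis
      by (cases "\<sigma> (x, y)") auto
  qed
  show "has_perfect_matching ({..<n} \<times> {..<k}) (tensor_transpose M)"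
    by (rule has_perfect_matching_mono_support[OF matching]) (use supp in auto)
qed

end
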